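(* Let $\Omega\subset\mathbb{R}^n$ be a bounded domain and let $\mathcal{S}\subset\Omega$ satisfy the outward ball property. Let $$L[u]=\sum_{i,j=1}^n a_{ij}u_{x_ix_j}+\sum_{i=1}^n b_iu_{x_i}+cu\quad\text{in }\Omega\setminus\mathcal{S}$$ be a linear elliptic operator with coefficients $a_{ij},b_i,c:\Omega\setminus\mathcal{S}\to\mathbb{R}$ ($i,j=1,\dots,n$), and suppose that $u\in C^2(\Omega)$ satisfies $L[u]\ge0$ on $\Omega\setminus\mathcal{S}$. Suppose that for each ball $B_R(x_0)\subset(\Omega\setminus\mathcal{S})$ for which $\partial B_R(x_0)\cap\partial\Omega=\emptyset$ there exists a continuous non-increasing function $\Lambda:\left(0,\tfrac R2\right]\to(0,\infty)$ with $\Lambda\in L^1\left(\left(0,\tfrac R2\right]\right)$ such that, writing $d(x)=d(\{x\},\partial B_R(x_0))$, the following hold for all $x\in B_R(x_0)$ with $d(x)\le\tfrac R2$: $$|y|^2\le\sum_{i,j=1}^n a_{ij}(x)y_iy_j\le\Lambda(d(x))\,|y|^2\quad\forall y\in\mathbb{R}^n,$$ $$|b_i(x)|\le\Lambda(d(x))\quad\text{for } i=1,\dots,n,$$ $$c(x)\ge\frac{-\Lambda(d(x))}{d(x)} .$$ Let $M_u=\sup_{x\in\Omega}u(x)$ and suppose that either $M_u=0$, or $M_u>0$ with $c$ non-positive. Then either $M_u>u(x)$ for all $x\in\Omega$, or $u$ is constant on $\Omega$.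
   Context: A bounded domain is an open connected bounded set. $B_R(x_0)\subset\mathbb{R}^n$ is the open Euclidean ball of radius $R$ centred at $x_0$, and $d(\{x\},Y)=\inf_{y\in Y}|x-y|$ is the Euclidean distance from $x$ to $Y$. Outward ball property: a set $\mathcal{S}\subset\Omega$ satisfies an outward ball property if, given any nonempty relatively closed set $\mathcal{T}\subset\Omega$ that is a strict subset of $\Omega$, there exist $R>0$ and $x_0\in\Omega\setminus(\mathcal{T}\cup\mathcal{S})$ such that $B_R(x_0)\subset\Omega\setminus(\mathcal{T}\cup\mathcal{S})$ and $\partial B_R(x_0)\cap\mathcal{T}\ne\emptyset$. The operator $L$ is linear elliptic in the sense that there exists a non-negative function $\Lambda_0:\Omega\setminus\mathcal{S}\to\mathbb{R}$ with $|y|^2\le\sum_{i,j=1}^n a_{ij}(x)y_iy_j\le\Lambda_0(x)|y|^2$ for all $x\in\Omega\setminus\mathcal{S}$, $y\in\mathbb{R}^n$. The coefficients are arbitrary prescribed real-valued functions (no continuity is assumed) and need not be defined on $\mathcal{S}$. *)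

theory Defs
  imports "HOL-Analysis.Analysis"
begin

definition bounded_domain :: "(real^'n) set \<Rightarrow> bool" where
  "bounded_domain \<Omega> \<longleftrightarrow> open \<Omega> \<and> connected \<Omega> \<and> bounded \<Omega>"

definition outward_ball_property :: "(real^'n) set \<Rightarrow> (real^'n) set \<Rightarrow> bool" where
  "outward_ball_property \<Omega> S \<longleftrightarrow>
     S \<subseteq> \<Omega> \<and>
     (\<forall>T. T \<noteq> {} \<and> closedin (top_of_set \<Omega>) T \<and> T \<subset> \<Omega> \<longrightarrow>
       (\<exists>R>0. \<exists>x0 \<in> \<Omega> - (T \<union> S).
          ball x0 R \<subseteq> \<Omega> - (T \<union> S) \<and> sphere x0 R \<inter> T \<noteq> {}))"

definition partial :: "'n \<Rightarrow> (real^'n \<Rightarrow> real) \<Rightarrow> real^'n \<Rightarrow> real" where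
  "partial i f x = deriv (\<lambda>t. f (x + t *\<^sub>R axis i 1)) 0"

text \<open>
  Intended for open \<open>\<Omega>\<close>. Differentiability is total (Frechet) differentiability; it makes the
  first partial derivatives continuous, so only those of second order need a continuity clause.
\<close>
definition C2_on :: "(real^'n \<Rightarrow> real) \<Rightarrow> (real^'n) set \<Rightarrow> bool" where
  "C2_on f \<Omega> \<longleftrightarrow>
     f differentiable_on \<Omega> \<and>
     (\<forall>i. partial i f differentiable_on \<Omega>) \<and>
     (\<forall>i j. continuous_on \<Omega> (partial j (partial i f)))"

text \<open>
  Coefficients are total functions; the values outside \<open>\<Omega> - S\<close> are never used.
\<close>
definition quad_form :: "('n \<Rightarrow> 'n \<Rightarrow> real^'n \<Rightarrow> real) \<Rightarrow> real^'n \<Rightarrow> real^'n \<Rightarrow> real" where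
  "quad_form a x y = (\<Sum>i\<in>UNIV. \<Sum>j\<in>UNIV. a i j x * y $ i * y $ j)"

definition elliptic_on :: "(real^'n) set \<Rightarrow> ('n \<Rightarrow> 'n \<Rightarrow> real^'n \<Rightarrow> real) \<Rightarrow> bool" where
  "elliptic_on D a \<longleftrightarrow>
     (\<exists>\<Lambda>0 :: real^'n \<Rightarrow> real. \<forall>x\<in>D. 0 \<le> \<Lambda>0 x \<and>
        (\<forall>y. (norm y)\<^sup>2 \<le> quad_form a x y \<and> quad_form a x y \<le> \<Lambda>0 x * (norm y)\<^sup>2))"

definition linop ::
  "('n \<Rightarrow> 'n \<Rightarrow> real^'n \<Rightarrow> real) \<Rightarrow> ('n \<Rightarrow> real^'n \<Rightarrow> real) \<Rightarrow> (real^'n \<Rightarrow> real)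
    \<Rightarrow> (real^'n \<Rightarrow> real) \<Rightarrow> real^'n \<Rightarrow> real" where
  "linop a b c u x =
     (\<Sum>i\<in>UNIV. \<Sum>j\<in>UNIV. a i j x * partial j (partial i u) x)
     + (\<Sum>i\<in>UNIV. b i x * partial i u x) + c x * u x"

end

theory Submission
  imports Defs
begin

text \<open>
  Suppose that the supremum \<open>M\<close> is attained but \<open>u\<close> is not constant. The set \<open>T\<close> of maximum points is
  then a proper relatively closed subset of \<open>\<Omega>\<close>, and the outward ball property gives a ball avoiding
  \<open>T\<close> and \<open>S\<close> whose boundary touches \<open>T\<close> at some \<open>z\<close>. The ball of half the radius that is internally
  tangent at \<open>z\<close> has its closure inside \<open>\<Omega>\<close> (lemma \<open>cball_midpoint_subset_insert_ball\<close>), so the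
  bounds by \<open>\<Lambda>\<close> are available on it. The gradient of \<open>u\<close> vanishes at \<open>z\<close>, an interior maximum point; the point \<open>z\<close> may
  lie in \<open>S\<close>, but the equation is only needed in the open ball. The contradiction is a Hopf boundary
  point estimate: \<open>v = M - u\<close> grows at least linearly as one moves from \<open>z\<close> towards the centre.

  Both alternatives for the sign of \<open>M\<close> give \<open>c M \<le> 0\<close>. Hence, wherever \<open>v > 0\<close>,
  \<open>c u = c M - c v \<le> \<Lambda>(d) v / d\<close>, and the inequality \<open>L[u] \<ge> 0\<close> becomes a differential
  inequality for \<open>v\<close> with a zeroth-order coefficient that may blow up at the sphere like \<open>\<Lambda>(d) / d\<close>.

  The comparison function is \<open>W(s)\<close> with \<open>s = (R^2 - |x - x0|^2) / (2 R)\<close>. Using \<open>s\<close> in place of the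
  distance \<open>d\<close> to the sphere makes the spatial derivatives polynomial, and it costs nothing:
  \<open>s \<le> d\<close>, so \<open>\<Lambda>(d) \<le> \<Lambda>(s)\<close> because \<open>\<Lambda>\<close> is non-increasing. The profile is
  \<open>W'(s) = exp (K \<integral>\<^sub>0\<^sup>s \<Lambda>)\<close>, which is finite because \<open>\<Lambda>\<close> is integrable. Then \<open>W'' = K \<Lambda> W'\<close> absorbs
  all first-order terms and the trace of the matrix \<open>a\<close> once \<open>K\<close> is large, and convexity, in the form
  \<open>W(s) \<le> s W'(s)\<close>, absorbs the zeroth-order term \<open>\<Lambda>(s) W(s) / s\<close> too
  (lemma \<open>barrier_exists\<close>).

  On the annulus of thickness \<open>R/2\<close> a small multiple \<open>\<epsilon> W\<close> lies below \<open>v\<close> on the boundary. A negative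
  interior minimum of \<open>v - \<epsilon> W\<close> is impossible: there the gradients agree and the Hessian of the
  difference is positive semidefinite, so its trace product with \<open>a\<close> is nonnegative
  (lemma \<open>trace_prod_nonneg\<close>), which contradicts the strict inequality satisfied by \<open>W\<close>
  (lemma \<open>barrier_lower_bound\<close>). So \<open>v \<ge> \<epsilon> s\<close>, which is the linear growth wanted.
\<close>

section \<open>The trace of a product of positive semidefinite matrices\<close>

text \<open>
  Eliminating the variable \<open>p\<close> by completing the square: if \<open>h\<^sub>p\<^sub>p > 0\<close>, then \<open>h\<close> is the sum of the
  rank-one form \<open>h\<^sub>p\<^sub>i h\<^sub>p\<^sub>j / h\<^sub>p\<^sub>p\<close>, whose pairing with \<open>a\<close> is a value of the quadratic form of \<open>a\<close>, and of
  a positive semidefinite form in the remaining variables. If \<open>h\<^sub>p\<^sub>p = 0\<close>, the whole row vanishes.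
  The matrix \<open>a\<close> may be asymmetric, which is why \<open>h\<close> has to be symmetric.
\<close>
lemma trace_prod_nonneg:
  fixes a h :: "'i \<Rightarrow> 'i \<Rightarrow> real"
  assumes "finite I"
    and a: "\<And>y. (\<Sum>i\<in>I. \<Sum>j\<in>I. a i j * y i * y j) \<ge> 0"
    and sym: "\<And>i j. i \<in> I \<Longrightarrow> j \<in> I \<Longrightarrow> h i j = h j i"
    and h: "\<And>y. (\<Sum>i\<in>I. \<Sum>j\<in>I. h i j * y i * y j) \<ge> 0"
  shows "(\<Sum>i\<in>I. \<Sum>j\<in>I. a i j * h i j) \<ge> 0"
  using assms
proof (induction I arbitrary: h rule: finite_induct)
  case empty
  then show ?case by simp
next
  case (insert p I)
  let ?J = "insert p I"
  have expand: "(\<Sum>i\<in>?J. \<Sum>j\<in>?J. k i j) = k p p + (\<Sum>j\<in>I. k p j) + (\<Sum>i\<in>I. k i p) + (\<Sum>i\<in>I. \<Sum>j\<in>I. k i j)"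
    for k :: "'i \<Rightarrow> 'i \<Rightarrow> real"
    using insert.hyps by (simp add: sum.distrib)
  have a_I: "(\<Sum>i\<in>I. \<Sum>j\<in>I. a i j * y i * y j) \<ge> 0" for y
  proof -
    have "(\<Sum>i\<in>I. \<Sum>j\<in>I. a i j * (y(p:=0)) i * (y(p:=0)) j) = (\<Sum>i\<in>I. \<Sum>j\<in>I. a i j * y i * y j)"
      using insert.hyps by (intro sum.cong refl) auto
    then show ?thesis
      using insert.prems(1)[of "y(p:=0)"] unfolding expand by simp
  qed
  have quad: "0 \<le> t\<^sup>2 * h p p + 2 * t * (\<Sum>j\<in>I. h p j * y j) + (\<Sum>i\<in>I. \<Sum>j\<in>I. h i j * y i * y j)" for t y
  proof -
    have c: "(\<Sum>i\<in>I. \<Sum>j\<in>I. h i j * (y(p:=t)) i * (y(p:=t)) j) = (\<Sum>i\<in>I. \<Sum>j\<in>I. h i j * y i * y j)"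
      using insert.hyps by (intro sum.cong refl) auto
    have r: "(\<Sum>j\<in>I. h p j * (y(p:=t)) p * (y(p:=t)) j) = t * (\<Sum>j\<in>I. h p j * y j)"
      unfolding sum_distrib_left using insert.hyps by (intro sum.cong refl) auto
    have l: "(\<Sum>i\<in>I. h i p * (y(p:=t)) i * (y(p:=t)) p) = t * (\<Sum>j\<in>I. h p j * y j)"
      unfolding sum_distrib_left using insert.hyps insert.prems(2)
      by (intro sum.cong refl) auto
    show ?thesis
      using insert.prems(3)[of "y(p:=t)"] unfolding expand c r l
      by (simp add: power2_eq_square algebra_simps)
  qed
  have hpp: "h p p \<ge> 0"
    using quad[of 1 "\<lambda>_. 0"] by simp
  define g where "g i j = h i j - h p i * h p j / h p p" for i j
  show ?case
  proof (cases "h p p = 0")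
    case True
    have z: "h p k = 0" if k: "k \<in> I" for k
    proof (rule ccontr)
      assume ne: "h p k \<noteq> 0"
      \<comment> \<open>With a zero diagonal entry the form is affine in the \<open>p\<close>-coordinate, and a nonzero slope
        makes it negative: the coordinate \<open>- (h k k + 1) / (2 h p k)\<close>, on top of the \<open>k\<close>-th
        unit vector, gives the value \<open>-1\<close>.\<close>
      define y where "y = (\<lambda>j. if j = k then (1::real) else 0)"
      have 1: "(\<Sum>j\<in>I. h p j * y j) = h p k"
        using k insert.hyps by (simp add: y_def mult_delta_right)
      have 2: "(\<Sum>i\<in>I. \<Sum>j\<in>I. h i j * y i * y j) = h k k"
      proof -
        have "(\<Sum>j\<in>I. h i j * y i * y j) = (if i = k then h k k else 0)" for i
          using k insert.hyps by (simp add: y_def mult_delta_right mult_delta_left)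
        then show ?thesis using k insert.hyps by simp
      qed
      have "0 \<le> 2 * (-(h k k + 1) / (2 * h p k)) * h p k + h k k"
        using quad[of "-(h k k + 1) / (2 * h p k)" y] True unfolding 1 2 by simp
      also have "\<dots> = -1" using ne by (simp add: field_simps)
      finally show False by simp
    qed
    have z': "h k p = 0" if k: "k \<in> I" for k
      using z[OF k] insert.prems(2)[of k p] k by simp
    have hI: "(\<Sum>i\<in>I. \<Sum>j\<in>I. h i j * y i * y j) \<ge> 0" for y
      using quad[of 0 y] by simp
    have "(\<Sum>i\<in>I. \<Sum>j\<in>I. a i j * h i j) \<ge> 0"
      using insert.IH[of h] a_I hI insert.prems(2) by auto
    then show ?thesis
      unfolding expand using True z z' by simp
  next
    case False
    then have pos: "h p p > 0" using hpp by simp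
    have gsym: "g i j = g j i" if "i \<in> I" "j \<in> I" for i j
      using insert.prems(2) that by (simp add: g_def mult.commute)
    have gI: "(\<Sum>i\<in>I. \<Sum>j\<in>I. g i j * y i * y j) \<ge> 0" for y
    proof -
      let ?s = "\<Sum>j\<in>I. h p j * y j"
      have "(\<Sum>i\<in>I. \<Sum>j\<in>I. g i j * y i * y j) =
            (\<Sum>i\<in>I. \<Sum>j\<in>I. h i j * y i * y j) - (\<Sum>i\<in>I. \<Sum>j\<in>I. (h p i * y i) * (h p j * y j) / h p p)"
        unfolding g_def by (simp add: sum_subtractf[symmetric] algebra_simps)
      also have "(\<Sum>i\<in>I. \<Sum>j\<in>I. (h p i * y i) * (h p j * y j) / h p p) = ?s\<^sup>2 / h p p"
        by (simp add: power2_eq_square sum_product sum_divide_distrib)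
      finally have *: "(\<Sum>i\<in>I. \<Sum>j\<in>I. g i j * y i * y j) = (\<Sum>i\<in>I. \<Sum>j\<in>I. h i j * y i * y j) - ?s\<^sup>2 / h p p" .
      show ?thesis
        using quad[of "- ?s / h p p" y] pos unfolding *
        by (simp add: power2_eq_square field_simps)
    qed
    have IH: "(\<Sum>i\<in>I. \<Sum>j\<in>I. a i j * g i j) \<ge> 0"
      using insert.IH[of g] a_I gI gsym by auto
    have gp: "g p j = 0" for j using pos by (simp add: g_def)
    have gp': "g i p = 0" if "i \<in> I" for i
      using pos insert.prems(2)[of i p] that by (simp add: g_def)
    have "(\<Sum>i\<in>?J. \<Sum>j\<in>?J. a i j * h i j) =
      (\<Sum>i\<in>?J. \<Sum>j\<in>?J. a i j * g i j) + (\<Sum>i\<in>?J. \<Sum>j\<in>?J. a i j * h p i * h p j / h p p)"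
      unfolding sum.distrib[symmetric] g_def by (intro sum.cong refl) (simp add: algebra_simps)
    moreover have "(\<Sum>i\<in>?J. \<Sum>j\<in>?J. a i j * g i j) \<ge> 0"
      unfolding expand using IH gp gp' by simp
    moreover have "(\<Sum>i\<in>?J. \<Sum>j\<in>?J. a i j * h p i * h p j / h p p) \<ge> 0"
      using insert.prems(1)[of "h p"] pos unfolding sum_divide_distrib[symmetric]
      by (meson divide_nonneg_pos)
    ultimately show ?thesis by simp
  qed
qed

section \<open>Partial derivatives\<close>

lemma has_derivative_partial:
  fixes f :: "real^'n \<Rightarrow> real"
  assumes "f differentiable_on \<Omega>" "open \<Omega>" "x \<in> \<Omega>"
  shows "(f has_derivative (\<lambda>y. \<Sum>i\<in>UNIV. partial i f x * y $ i)) (at x)"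
proof -
  obtain f' where f': "(f has_derivative f') (at x)"
    using assms by (metis at_within_open differentiable_def differentiable_on_def)
  then have lin: "linear f'" by (simp add: has_derivative_linear)
  have part: "partial i f x = f' (axis i 1)" for i
  proof -
    have "((\<lambda>t. x + t *\<^sub>R axis i 1) has_derivative (\<lambda>t. t *\<^sub>R axis i 1)) (at (0::real))"
      by (auto intro!: derivative_eq_intros)
    then have "((\<lambda>t. f (x + t *\<^sub>R axis i 1)) has_derivative (\<lambda>t. f' (t *\<^sub>R axis i 1))) (at (0::real))"
      by (rule has_derivative_compose) (simp add: f')
    then have "((\<lambda>t. f (x + t *\<^sub>R axis i 1)) has_real_derivative f' (axis i 1)) (at 0)"
      unfolding has_field_derivative_def
      by (simp add: linear_scale[OF lin] mult.commute[of _ "f' (axis i 1)"])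
    then show ?thesis unfolding partial_def by (rule DERIV_imp_deriv)
  qed
  have "f' y = (\<Sum>i\<in>UNIV. partial i f x * y $ i)" for y
  proof -
    have "f' y = f' (\<Sum>i\<in>UNIV. (y $ i) *s axis i 1)" by (simp add: basis_expansion)
    also have "\<dots> = (\<Sum>i\<in>UNIV. f' ((y $ i) *\<^sub>R axis i 1))"
      by (simp add: linear_sum[OF lin] scalar_mult_eq_scaleR)
    also have "\<dots> = (\<Sum>i\<in>UNIV. f' (axis i 1) * y $ i)"
      by (simp add: linear_scale[OF lin] mult.commute)
    also have "\<dots> = (\<Sum>i\<in>UNIV. partial i f x * y $ i)" unfolding part ..
    finally show ?thesis .
  qed
  then have "f' = (\<lambda>y. \<Sum>i\<in>UNIV. partial i f x * y $ i)" ..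
  then show ?thesis using f' by simp
qed

lemma DERIV_along_line:
  fixes f :: "real^'n \<Rightarrow> real"
  assumes "f differentiable_on \<Omega>" "open \<Omega>" "x + t *\<^sub>R y \<in> \<Omega>"
  shows "((\<lambda>t. f (x + t *\<^sub>R y)) has_real_derivative (\<Sum>i\<in>UNIV. partial i f (x + t *\<^sub>R y) * y $ i)) (at t)"
proof -
  have "((\<lambda>t. x + t *\<^sub>R y) has_derivative (\<lambda>t. t *\<^sub>R y)) (at t)"
    by (auto intro!: derivative_eq_intros)
  from has_derivative_compose[OF this has_derivative_partial[OF assms]]
  have "((\<lambda>t. f (x + t *\<^sub>R y)) has_derivative
      (\<lambda>s. \<Sum>i\<in>UNIV. partial i f (x + t *\<^sub>R y) * (s *\<^sub>R y) $ i)) (at t)" .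
  moreover have "(\<lambda>s. \<Sum>i\<in>UNIV. partial i f (x + t *\<^sub>R y) * (s *\<^sub>R y) $ i)
      = (*) (\<Sum>i\<in>UNIV. partial i f (x + t *\<^sub>R y) * y $ i)"
    unfolding fun_eq_iff sum_distrib_right by (simp add: mult_ac)
  ultimately show ?thesis
    unfolding has_field_derivative_def by simp
qed

lemma DERIV_along_axis:
  fixes f :: "real^'n \<Rightarrow> real"
  assumes "f differentiable_on \<Omega>" "open \<Omega>" "x + t *\<^sub>R axis i 1 \<in> \<Omega>"
  shows "((\<lambda>t. f (x + t *\<^sub>R axis i 1)) has_real_derivative partial i f (x + t *\<^sub>R axis i 1)) (at t)"
proof -
  have "(\<Sum>k\<in>UNIV. partial k f (x + t *\<^sub>R axis i 1) * axis i 1 $ k) = partial i f (x + t *\<^sub>R axis i 1)"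
    by (simp add: axis_def mult_delta_right)
  then show ?thesis using DERIV_along_line[OF assms] by simp
qed

text \<open>
  The mean value theorem is applied in direction \<open>i\<close> to the increment in direction \<open>j\<close>, and then in
  direction \<open>j\<close> to the resulting partial derivative. As the left-hand side is symmetric in \<open>i\<close>
  and \<open>j\<close>, letting \<open>h\<close> tend to 0 yields Schwarz's theorem.
\<close>
lemma second_difference_eq_mixed_partial:
  fixes u :: "real^'n \<Rightarrow> real"
  assumes "open \<Omega>" and C2: "C2_on u \<Omega>" and sub: "cball x (2 * h) \<subseteq> \<Omega>" and h: "h > 0"
  obtains \<xi> where "dist x \<xi> \<le> 2 * h"
    "u (x + h *\<^sub>R axis i 1 + h *\<^sub>R axis j 1) - u (x + h *\<^sub>R axis i 1) - u (x + h *\<^sub>R axis j 1) + u x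
       = h\<^sup>2 * partial j (partial i u) \<xi>"
proof -
  have du: "u differentiable_on \<Omega>" and dpu: "partial i u differentiable_on \<Omega>"
    using C2 by (auto simp: C2_on_def)
  have mem: "dist x (x + s *\<^sub>R axis i 1 + t *\<^sub>R axis j 1) \<le> 2 * h" if "0 \<le> s" "s \<le> h" "0 \<le> t" "t \<le> h" for s t
  proof -
    have "norm (s *\<^sub>R axis i 1 + t *\<^sub>R axis j (1::real)) \<le> norm (s *\<^sub>R axis i (1::real)) + norm (t *\<^sub>R axis j (1::real))"
      by (rule norm_triangle_ineq)
    also have "\<dots> \<le> 2 * h" using that by simp
    finally show ?thesis unfolding dist_commute[of x] by (simp add: dist_norm add.assoc)
  qed
  have in_Om: "x + s *\<^sub>R axis i 1 + t *\<^sub>R axis j 1 \<in> \<Omega>" if "0 \<le> s" "s \<le> h" "0 \<le> t" "t \<le> h" for s t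
    using mem[OF that] sub by (auto simp: subset_iff)
  let ?g = "\<lambda>s. u (x + h *\<^sub>R axis j 1 + s *\<^sub>R axis i 1) - u (x + s *\<^sub>R axis i 1)"
  have "\<exists>s>0. s < h \<and> ?g h - ?g 0 = (h - 0) * (partial i u (x + h *\<^sub>R axis j 1 + s *\<^sub>R axis i 1) - partial i u (x + s *\<^sub>R axis i 1))"
  proof (rule MVT2[OF h])
    fix s assume s: "0 \<le> s" "s \<le> h"
    have 1: "x + h *\<^sub>R axis j 1 + s *\<^sub>R axis i 1 \<in> \<Omega>"
      using in_Om[OF s, of h] h by (simp add: add.commute add.left_commute)
    have 2: "x + s *\<^sub>R axis i 1 \<in> \<Omega>"
      using in_Om[OF s, of 0] h by simp
    show "(?g has_real_derivative (partial i u (x + h *\<^sub>R axis j 1 + s *\<^sub>R axis i 1) - partial i u (x + s *\<^sub>R axis i 1))) (at s)"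
      by (intro DERIV_diff DERIV_along_axis[OF du assms(1)] 1 2)
  qed
  then obtain s where s: "0 < s" "s < h" and
    gs: "?g h - ?g 0 = h * (partial i u (x + h *\<^sub>R axis j 1 + s *\<^sub>R axis i 1) - partial i u (x + s *\<^sub>R axis i 1))"
    by auto
  have "\<exists>t>0. t < h \<and> partial i u (x + s *\<^sub>R axis i 1 + h *\<^sub>R axis j 1) - partial i u (x + s *\<^sub>R axis i 1 + 0 *\<^sub>R axis j 1)
      = (h - 0) * partial j (partial i u) (x + s *\<^sub>R axis i 1 + t *\<^sub>R axis j 1)"
    using s by (intro MVT2[OF h] DERIV_along_axis[OF dpu assms(1)] in_Om) auto
  then obtain t where t: "0 < t" "t < h" and
    gt: "partial i u (x + s *\<^sub>R axis i 1 + h *\<^sub>R axis j 1) - partial i u (x + s *\<^sub>R axis i 1)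
      = h * partial j (partial i u) (x + s *\<^sub>R axis i 1 + t *\<^sub>R axis j 1)"
    by auto
  have "?g h - ?g 0 = h * (h * partial j (partial i u) (x + s *\<^sub>R axis i 1 + t *\<^sub>R axis j 1))"
    unfolding gs gt[symmetric] by (simp add: add.commute add.left_commute)
  then have "u (x + h *\<^sub>R axis i 1 + h *\<^sub>R axis j 1) - u (x + h *\<^sub>R axis i 1) - u (x + h *\<^sub>R axis j 1) + u x
       = h\<^sup>2 * partial j (partial i u) (x + s *\<^sub>R axis i 1 + t *\<^sub>R axis j 1)"
    by (simp add: power2_eq_square add.commute add.left_commute)
  moreover have "dist x (x + s *\<^sub>R axis i 1 + t *\<^sub>R axis j 1) \<le> 2 * h"
    using mem s t by simp
  ultimately show thesis using that by blast
qed

lemma mixed_partials_commute: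
  fixes u :: "real^'n \<Rightarrow> real"
  assumes "open \<Omega>" and C2: "C2_on u \<Omega>" and x: "x \<in> \<Omega>"
  shows "partial j (partial i u) x = partial i (partial j u) x"
proof -
  let ?f = "partial j (partial i u)" and ?g = "partial i (partial j u)"
  have cf: "isCont ?f x" and cg: "isCont ?g x"
    using C2 x assms(1) by (auto simp: C2_on_def continuous_on_eq_continuous_at)
  obtain r where r: "r > 0" "cball x r \<subseteq> \<Omega>" using assms(1) x open_contains_cball by blast
  have "\<bar>?f x - ?g x\<bar> \<le> e" if e: "e > 0" for e
  proof -
    obtain d1 where d1: "d1 > 0" "\<And>y. dist y x < d1 \<Longrightarrow> dist (?f y) (?f x) < e/2"
      using cf e unfolding continuous_at_eps_delta by (metis half_gt_zero)
    obtain d2 where d2: "d2 > 0" "\<And>y. dist y x < d2 \<Longrightarrow> dist (?g y) (?g x) < e/2"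
      using cg e unfolding continuous_at_eps_delta by (metis half_gt_zero)
    define h where "h = min r (min d1 d2) / 4"
    have h: "h > 0" "2 * h \<le> r" "2 * h < d1" "2 * h < d2"
      using r d1 d2 by (auto simp: h_def)
    have sub: "cball x (2 * h) \<subseteq> \<Omega>" using h r by auto
    obtain p where p: "dist x p \<le> 2 * h"
      "u (x + h *\<^sub>R axis i 1 + h *\<^sub>R axis j 1) - u (x + h *\<^sub>R axis i 1) - u (x + h *\<^sub>R axis j 1) + u x = h\<^sup>2 * ?f p"
      using second_difference_eq_mixed_partial[OF assms(1) C2 sub h(1)] by blast
    obtain q where q: "dist x q \<le> 2 * h"
      "u (x + h *\<^sub>R axis j 1 + h *\<^sub>R axis i 1) - u (x + h *\<^sub>R axis j 1) - u (x + h *\<^sub>R axis i 1) + u x = h\<^sup>2 * ?g q"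
      using second_difference_eq_mixed_partial[OF assms(1) C2 sub h(1)] by blast
    have "x + h *\<^sub>R axis j 1 + h *\<^sub>R axis i 1 = x + h *\<^sub>R axis i 1 + h *\<^sub>R axis j 1"
      by (simp add: add.commute add.left_commute)
    note swap = this
    have "h\<^sup>2 * ?f p = h\<^sup>2 * ?g q"
      unfolding p(2)[symmetric] q(2)[symmetric] swap by simp
    then have "?f p = ?g q" using h by simp
    moreover have "dist (?f p) (?f x) < e/2" using d1(2)[of p] p h by (simp add: dist_commute)
    moreover have "dist (?g q) (?g x) < e/2" using d2(2)[of q] q h by (simp add: dist_commute)
    ultimately show ?thesis unfolding dist_real_def by linarith
  qed
  then have "\<bar>?f x - ?g x\<bar> \<le> 0" by (rule field_le_epsilon) simp
  then show ?thesis by simp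
qed

text \<open>
  If the second derivative were negative, \<open>g'\<close> would be negative just to the right of 0, so \<open>g\<close> would
  fall below \<open>g 0\<close> there.
\<close>
lemma local_min_second_order:
  fixes g g' :: "real \<Rightarrow> real"
  assumes "d > 0"
    and g: "\<And>t. \<bar>t\<bar> < d \<Longrightarrow> (g has_real_derivative g' t) (at t)"
    and g': "(g' has_real_derivative D) (at 0)"
    and min: "\<And>t. \<bar>t\<bar> < d \<Longrightarrow> g 0 \<le> g t"
  shows "g' 0 = 0" "D \<ge> 0"
proof -
  show 0: "g' 0 = 0"
    using DERIV_local_min[OF g[of 0] assms(1)] min assms(1) by simp
  show "D \<ge> 0"
  proof (rule ccontr)
    assume "\<not> D \<ge> 0"
    then obtain e where e: "e > 0" "\<And>h. 0 < h \<Longrightarrow> h < e \<Longrightarrow> g' (0 + h) < g' 0"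
      using DERIV_neg_dec_right[OF g'] by fastforce
    define b where "b = min d e / 2"
    have b: "0 < b" "b < d" "b < e" using assms(1) e by (auto simp: b_def)
    obtain z where z: "0 < z" "z < b" "g b - g 0 = (b - 0) * g' z"
      using MVT2[OF b(1), of g g'] g b by force
    have "g' z < 0" using e(2)[of z] z b 0 by simp
    then have "g b - g 0 < 0" using z b by (simp add: mult_pos_neg)
    moreover have "g 0 \<le> g b" using min[of b] b by simp
    ultimately show False by simp
  qed
qed

section \<open>The comparison function\<close>

text \<open>
  \<open>W'\<close> is the exponential of \<open>K\<close> times the primitive \<open>F\<close> of \<open>\<Lambda>\<close>, and \<open>W\<close> is a primitive of \<open>W'\<close>.
  Integrability of \<open>\<Lambda>\<close> up to 0 makes \<open>F\<close> continuous on the closed interval, although \<open>\<Lambda>\<close> may be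
  unbounded. The two-sided bound on \<open>W\<close> holds since \<open>W'\<close> is nondecreasing and at least 1.
\<close>
lemma barrier_exists:
  fixes \<Lambda> :: "real \<Rightarrow> real"
  assumes cont: "continuous_on {0<..\<rho>} \<Lambda>" and pos: "\<And>t. t \<in> {0<..\<rho>} \<Longrightarrow> \<Lambda> t \<ge> 0"
    and int: "set_integrable lborel {0<..\<rho>} \<Lambda>" and K: "K \<ge> 0"
  obtains W W' :: "real \<Rightarrow> real" where
    "continuous_on {0..\<rho>} W"
    "\<And>s. s \<in> {0<..<\<rho>} \<Longrightarrow> (W has_real_derivative W' s) (at s)"
    "\<And>s. s \<in> {0<..<\<rho>} \<Longrightarrow> (W' has_real_derivative K * \<Lambda> s * W' s) (at s)"
    "\<And>s. s \<in> {0..\<rho>} \<Longrightarrow> s \<le> W s" "\<And>s. s \<in> {0..\<rho>} \<Longrightarrow> W s \<le> s * W' s"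
    "W 0 = 0"
    "\<And>s. s \<in> {0..\<rho>} \<Longrightarrow> W' s \<ge> 1"
proof -
  define F where "F s = integral {0..s} \<Lambda>" for s
  define W' where "W' s = exp (K * F s)" for s
  define W where "W s = integral {0..s} W'" for s
  have "\<Lambda> integrable_on {0<..\<rho>}"
    using int by (rule set_borel_integral_eq_integral)
  moreover have "{0..\<rho>} = {0<..\<rho>} \<or> {0..\<rho>} = insert 0 {0<..\<rho>}"
    by force
  ultimately have intA: "\<Lambda> integrable_on {0..\<rho>}"
    using integrable_on_insert_iff by metis
  have intB: "\<Lambda> integrable_on {0..s}" if "s \<le> \<rho>" for s
    using integrable_on_subinterval[OF intA, of 0 s] that by auto
  have F_mono: "F s \<le> F t" if "0 \<le> s" "s \<le> t" "t \<le> \<rho>" for s t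
  proof -
    have st: "\<Lambda> integrable_on {s..t}"
      using integrable_on_subinterval[OF intA, of s t] that by auto
    have "F t = F s + integral {s..t} \<Lambda>"
      unfolding F_def using Henstock_Kurzweil_Integration.integral_combine[of 0 s t \<Lambda>] intB that by simp
    moreover have "integral {s..t} \<Lambda> = integral {s<..t} \<Lambda>"
      by (rule integral_spike_set) (auto intro: negligible_subset[of "{s}"])
    moreover have "integral {s<..t} \<Lambda> \<ge> 0"
    proof (rule integral_nonneg)
      have "{s..t} = {s<..t} \<or> {s..t} = insert s {s<..t}" by force
      then show "\<Lambda> integrable_on {s<..t}"
        using st integrable_on_insert_iff by metis
    qed (use pos that in auto)
    ultimately show ?thesis by simp
  qed
  have F0: "F 0 = 0" by (simp add: F_def)
  have contF: "continuous_on {0..\<rho>} F"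
    unfolding F_def using indefinite_integral_continuous_1[OF intA] .
  have contW': "continuous_on {0..\<rho>} W'"
    unfolding W'_def using contF by (intro continuous_intros)
  have derF: "(F has_real_derivative \<Lambda> s) (at s)" if s: "s \<in> {0<..<\<rho>}" for s
  proof -
    have "isCont \<Lambda> s"
      using continuous_on_subset[OF cont, of "{0<..<\<rho>}"] s
      by (auto simp: continuous_on_eq_continuous_at subset_iff)
    then have "((\<lambda>u. integral {0..u} \<Lambda>) has_vector_derivative \<Lambda> s) (at s within ({0..\<rho>} - {}))"
      using s intA by (intro integral_has_vector_derivative_continuous_at) (auto intro: continuous_at_imp_continuous_at_within)
    then have "(F has_real_derivative \<Lambda> s) (at s within {0..\<rho>})"
      by (simp add: has_real_derivative_iff_has_vector_derivative F_def[abs_def])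
    then show ?thesis using s at_within_interior[of s "{0..\<rho>}"] by simp
  qed
  have W'1: "W' s \<ge> 1" if "s \<in> {0..\<rho>}" for s
    using F_mono[of 0 s] F0 K that by (simp add: W'_def)
  have W'mono: "W' s \<le> W' t" if "0 \<le> s" "s \<le> t" "t \<le> \<rho>" for s t
    using F_mono[OF that] K by (simp add: W'_def mult_left_mono)
  have W'int: "W' integrable_on {0..s}" if "s \<le> \<rho>" for s
    using continuous_on_subset[OF contW', of "{0..s}"] that by (intro integrable_continuous_real) auto
  show thesis
  proof
    show "continuous_on {0..\<rho>} W"
      unfolding W_def using indefinite_integral_continuous_1[OF W'int[of \<rho>]] by simp
    show "(W has_real_derivative W' s) (at s)" if s: "s \<in> {0<..<\<rho>}" for s
    proof -
      have "(W has_real_derivative W' s) (at s within {0..\<rho>})"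
        unfolding W_def[abs_def] using integral_has_real_derivative[OF contW', of s] s by simp
      then show ?thesis using s at_within_interior[of s "{0..\<rho>}"] by simp
    qed
    show "(W' has_real_derivative K * \<Lambda> s * W' s) (at s)" if s: "s \<in> {0<..<\<rho>}" for s
      unfolding W'_def[abs_def] by (auto intro!: derivative_eq_intros derF[OF s])
    show "s \<le> W s" if s: "s \<in> {0..\<rho>}" for s
    proof -
      have "integral {0..s} (\<lambda>_. 1) \<le> W s"
        unfolding W_def using s W'1 by (intro integral_le W'int) auto
      then show ?thesis using s by simp
    qed
    show "W s \<le> s * W' s" if s: "s \<in> {0..\<rho>}" for s
    proof -
      have "W s \<le> integral {0..s} (\<lambda>_. W' s)"
        unfolding W_def using s W'mono by (intro integral_le W'int) auto
      then show ?thesis using s by simp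
    qed
    show "W 0 = 0" by (simp add: W_def)
  qed (use W'1 in auto)
qed

section \<open>The boundary point estimate\<close>

lemma infdist_sphere:
  fixes x0 x :: "real^'n"
  assumes "x \<in> ball x0 R"
  shows "infdist x (sphere x0 R) = R - dist x0 x"
proof -
  have R: "R > 0" using assms by (metis ball_eq_empty empty_iff not_le)
  obtain e :: "real^'n" where e: "norm e = 1" "x - x0 = norm (x - x0) *\<^sub>R e"
  proof (cases "x = x0")
    case True
    obtain e :: "real^'n" where "norm e = 1" using vector_choose_size[of 1] by auto
    then show thesis using that True by auto
  next
    case False
    then show thesis using that[of "(x - x0) /\<^sub>R norm (x - x0)"] by simp
  qed
  let ?p = "x0 + R *\<^sub>R e"
  have p: "?p \<in> sphere x0 R" using e R by (simp add: dist_norm)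
  show ?thesis
  proof (rule antisym)
    have "infdist x (sphere x0 R) \<le> dist x ?p" by (rule infdist_le[OF p])
    also have "x - ?p = (norm (x - x0) - R) *\<^sub>R e"
      using e(2) by (simp add: algebra_simps)
    then have "dist x ?p = \<bar>norm (x - x0) - R\<bar>" using e(1) by (simp add: dist_norm)
    also have "\<dots> = R - dist x0 x" using assms by (simp add: dist_norm norm_minus_commute)
    finally show "infdist x (sphere x0 R) \<le> R - dist x0 x" .
    have "R - dist x0 x \<le> dist x y" if "y \<in> sphere x0 R" for y
      using dist_triangle[of x0 y x] that by simp
    then show "R - dist x0 x \<le> infdist x (sphere x0 R)"
      using p R by (subst infdist_notempty) (auto intro!: cINF_greatest)
  qed
qed

text \<open>
  The first- and second-order conditions at a minimum \<open>p\<close> of \<open>M - u - \<epsilon> W(\<sigma>)\<close>, with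
  \<open>\<sigma> = (R^2 - |x - x0|^2) / (2 R)\<close>. With \<open>q = p - x0\<close>, the composite \<open>W(\<sigma>)\<close> has gradient \<open>- W' q / R\<close>
  and Hessian \<open>W'' q q\<^sup>T / R^2 - W' I / R\<close> at \<open>p\<close>. Both conditions are read off along lines through
  \<open>p\<close>, so that only one-dimensional calculus is involved; positivity of the Hessian is then paired with
  the matrix \<open>a\<close>.
\<close>
lemma barrier_contact_conditions:
  fixes u :: "real^'n \<Rightarrow> real" and a :: "'n \<Rightarrow> 'n \<Rightarrow> real" and \<epsilon> M R \<rho> W2 :: real
  defines "\<sigma> \<equiv> \<lambda>x0 x :: real^'n. (R\<^sup>2 - (norm (x - x0))\<^sup>2) / (2 * R)"
  assumes "open \<Omega>" and C2: "C2_on u \<Omega>" and R: "R > 0"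
    and U: "open U" "p \<in> U" "U \<subseteq> \<Omega>" "\<And>x. x \<in> U \<Longrightarrow> \<sigma> x0 x \<in> {0<..<\<rho>}"
    and W: "\<And>s. s \<in> {0<..<\<rho>} \<Longrightarrow> (W has_real_derivative W' s) (at s)"
    and W': "(W' has_real_derivative W2) (at (\<sigma> x0 p))"
    and min: "\<And>x. x \<in> U \<Longrightarrow> M - u p - \<epsilon> * W (\<sigma> x0 p) \<le> M - u x - \<epsilon> * W (\<sigma> x0 x)"
  shows "partial k u p = \<epsilon> * W' (\<sigma> x0 p) * (p - x0) $ k / R"
    and "(\<And>y. (\<Sum>i\<in>UNIV. \<Sum>j\<in>UNIV. a i j * y i * y j) \<ge> 0) \<Longrightarrow>
      (\<Sum>i\<in>UNIV. \<Sum>j\<in>UNIV. a i j * partial j (partial i u) p)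
        \<le> - \<epsilon> * (W2 / R\<^sup>2 * (\<Sum>i\<in>UNIV. \<Sum>j\<in>UNIV. a i j * (p - x0) $ i * (p - x0) $ j)
               - W' (\<sigma> x0 p) / R * (\<Sum>i\<in>UNIV. a i i))"
proof -
  define q where "q = p - x0"
  define w1 where "w1 = W' (\<sigma> x0 p)"
  have du: "u differentiable_on \<Omega>" and dpu: "\<And>i. partial i u differentiable_on \<Omega>"
    using C2 by (auto simp: C2_on_def)
  have pOm: "p \<in> \<Omega>" using U by auto
  have line: "- (\<Sum>i\<in>UNIV. partial i u p * y $ i) + \<epsilon> * w1 * (q \<bullet> y) / R = 0 \<and>
      - (\<Sum>i\<in>UNIV. (\<Sum>j\<in>UNIV. partial j (partial i u) p * y $ j) * y $ i)
      - \<epsilon> * (W2 * (q \<bullet> y)\<^sup>2 / R\<^sup>2 - w1 * (y \<bullet> y) / R) \<ge> 0" for y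
  proof -
    define sg where "sg t = (R\<^sup>2 - (q \<bullet> q + 2 * t * (q \<bullet> y) + t\<^sup>2 * (y \<bullet> y))) / (2 * R)" for t
    define sg' where "sg' t = - (q \<bullet> y + t * (y \<bullet> y)) / R" for t
    have sg: "\<sigma> x0 (p + t *\<^sub>R y) = sg t" for t
    proof -
      have "p + t *\<^sub>R y - x0 = q + t *\<^sub>R y" by (simp add: q_def)
      then show ?thesis
        unfolding \<sigma>_def sg_def power2_norm_eq_inner
        by (simp add: inner_add_left inner_add_right inner_commute power2_eq_square algebra_simps)
    qed
    have dsg: "(sg has_real_derivative sg' t) (at t)" for t
      unfolding sg_def[abs_def] sg'_def using R
      by (auto intro!: derivative_eq_intros simp: field_simps)
    have dsg': "(sg' has_real_derivative - (y \<bullet> y) / R) (at t)" for t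
      unfolding sg'_def[abs_def] using R
      by (auto intro!: derivative_eq_intros simp: field_simps)
    obtain e where e: "e > 0" "ball p e \<subseteq> U" using U open_contains_ball by blast
    define d where "d = e / (norm y + 1)"
    have d: "d > 0" using e by (simp add: d_def add_nonneg_pos)
    have inU: "p + t *\<^sub>R y \<in> U" if "\<bar>t\<bar> < d" for t
    proof -
      have "\<bar>t\<bar> * norm y \<le> \<bar>t\<bar> * (norm y + 1)" by (simp add: mult_left_mono)
      also have "\<dots> < e" using that by (simp add: d_def pos_less_divide_eq add_nonneg_pos)
      finally show ?thesis using e by (auto simp: dist_norm)
    qed
    define g where "g t = M - u (p + t *\<^sub>R y) - \<epsilon> * W (sg t)" for t
    define g' where "g' t = - (\<Sum>i\<in>UNIV. partial i u (p + t *\<^sub>R y) * y $ i) - \<epsilon> * (W' (sg t) * sg' t)" for t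
    have dg: "(g has_real_derivative g' t) (at t)" if t: "\<bar>t\<bar> < d" for t
    proof -
      have "((\<lambda>t. W (sg t)) has_real_derivative W' (sg t) * sg' t) (at t)"
        using W[of "sg t"] U(4)[OF inU[OF t]] dsg[of t] unfolding sg by (auto intro: DERIV_chain2)
      moreover have "((\<lambda>t. u (p + t *\<^sub>R y)) has_real_derivative (\<Sum>i\<in>UNIV. partial i u (p + t *\<^sub>R y) * y $ i)) (at t)"
        using inU[OF t] U by (intro DERIV_along_line[OF du assms(2)]) auto
      ultimately show ?thesis
        unfolding g_def[abs_def] g'_def by (auto intro!: derivative_eq_intros)
    qed
    have sg0: "sg 0 = \<sigma> x0 p" using sg[of 0] by simp
    have sg'0: "sg' 0 = - (q \<bullet> y) / R" by (simp add: sg'_def)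
    have dg': "(g' has_real_derivative - (\<Sum>i\<in>UNIV. (\<Sum>j\<in>UNIV. partial j (partial i u) p * y $ j) * y $ i)
        - \<epsilon> * (W2 * (q \<bullet> y)\<^sup>2 / R\<^sup>2 - w1 * (y \<bullet> y) / R)) (at 0)"
    proof -
      have 1: "((\<lambda>t. W' (sg t)) has_real_derivative W2 * sg' 0) (at 0)"
        using W' dsg[of 0] unfolding sg0[symmetric] by (rule DERIV_chain2)
      have 2: "((\<lambda>t. W' (sg t) * sg' t) has_real_derivative W2 * sg' 0 * sg' 0 + - (y \<bullet> y) / R * W' (sg 0)) (at 0)"
        by (rule DERIV_mult[OF 1 dsg'])
      have "W2 * sg' 0 * sg' 0 + - (y \<bullet> y) / R * W' (sg 0) = W2 * (q \<bullet> y)\<^sup>2 / R\<^sup>2 - w1 * (y \<bullet> y) / R"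
        unfolding sg'0 sg0 w1_def[symmetric] by (simp add: power2_eq_square mult_ac)
      note 3 = 2[unfolded this]
      have 4: "((\<lambda>t. partial i u (p + t *\<^sub>R y)) has_real_derivative (\<Sum>j\<in>UNIV. partial j (partial i u) p * y $ j)) (at 0)" for i
        using DERIV_along_line[OF dpu assms(2), of p 0 y i] pOm by simp
      have 5: "((\<lambda>t. \<Sum>i\<in>UNIV. partial i u (p + t *\<^sub>R y) * y $ i) has_real_derivative
           (\<Sum>i\<in>UNIV. (\<Sum>j\<in>UNIV. partial j (partial i u) p * y $ j) * y $ i)) (at 0)"
        by (intro DERIV_sum DERIV_cmult_right 4)
      show ?thesis
        unfolding g'_def[abs_def] by (intro DERIV_diff DERIV_minus DERIV_cmult 3 5)
    qed
    have gmin: "g 0 \<le> g t" if "\<bar>t\<bar> < d" for t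
      using min[OF inU[OF that]] unfolding g_def sg sg0 by simp
    have "g' 0 = - (\<Sum>i\<in>UNIV. partial i u p * y $ i) + \<epsilon> * w1 * (q \<bullet> y) / R"
      unfolding g'_def sg'0 sg0 w1_def[symmetric] by simp
    then show ?thesis
      using local_min_second_order[OF d dg dg' gmin] by metis
  qed
  have "(\<Sum>i\<in>UNIV. partial i u p * axis k 1 $ i) = partial k u p"
    by (simp add: axis_def mult_delta_right)
  then show "partial k u p = \<epsilon> * W' (\<sigma> x0 p) * (p - x0) $ k / R"
    using line[of "axis k 1"] by (simp add: inner_axis q_def w1_def)
  define H where "H i j = - partial j (partial i u) p
     - \<epsilon> * (W2 / R\<^sup>2 * (q $ i * q $ j) - w1 / R * (if i = j then 1 else 0))" for i j
  have Hsum: "(\<Sum>i\<in>UNIV. \<Sum>j\<in>UNIV. k i j * H i j) =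
      - (\<Sum>i\<in>UNIV. \<Sum>j\<in>UNIV. k i j * partial j (partial i u) p)
      - \<epsilon> * (W2 / R\<^sup>2 * (\<Sum>i\<in>UNIV. \<Sum>j\<in>UNIV. k i j * q $ i * q $ j) - w1 / R * (\<Sum>i\<in>UNIV. k i i))"
    for k :: "'n \<Rightarrow> 'n \<Rightarrow> real"
  proof -
    have tr: "(\<Sum>i\<in>UNIV. k i i) = (\<Sum>i\<in>UNIV. \<Sum>j\<in>UNIV. k i j * (if i = j then 1 else 0))"
      by (simp add: mult_delta_right)
    show ?thesis
      unfolding tr H_def
      by (simp only: sum_distrib_left sum_subtractf[symmetric] sum_negf[symmetric])
        (intro sum.cong refl, simp add: algebra_simps)
  qed
  have Hsym: "H i j = H j i" for i j
    using mixed_partials_commute[OF assms(2) C2 pOm, of i j] by (simp add: H_def mult.commute)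
  have Hpsd: "(\<Sum>i\<in>UNIV. \<Sum>j\<in>UNIV. H i j * z i * z j) \<ge> 0" for z
  proof -
    define y :: "real^'n" where "y = (\<chi> i. z i)"
    have 1: "(\<Sum>i\<in>UNIV. \<Sum>j\<in>UNIV. H i j * z i * z j) = (\<Sum>i\<in>UNIV. \<Sum>j\<in>UNIV. (z i * z j) * H i j)"
      by (simp add: mult_ac)
    have 2: "(\<Sum>i\<in>UNIV. z i * z i) = y \<bullet> y" by (simp add: y_def inner_vec_def)
    have 3: "(\<Sum>i\<in>UNIV. \<Sum>j\<in>UNIV. z i * z j * q $ i * q $ j) = (q \<bullet> y)\<^sup>2"
      by (simp add: y_def inner_vec_def power2_eq_square sum_product mult_ac)
    have 4: "(\<Sum>i\<in>UNIV. \<Sum>j\<in>UNIV. z i * z j * partial j (partial i u) p)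
        = (\<Sum>i\<in>UNIV. (\<Sum>j\<in>UNIV. partial j (partial i u) p * y $ j) * y $ i)"
      by (simp add: y_def sum_distrib_left mult_ac)
    show ?thesis
      unfolding 1 Hsum 2 3 4 using line[of y] by simp
  qed
  assume a_psd: "\<And>y. (\<Sum>i\<in>UNIV. \<Sum>j\<in>UNIV. a i j * y i * y j) \<ge> 0"
  have "(\<Sum>i\<in>UNIV. \<Sum>j\<in>UNIV. a i j * H i j) \<ge> 0"
    by (rule trace_prod_nonneg[OF finite a_psd Hsym Hpsd])
  then show "(\<Sum>i\<in>UNIV. \<Sum>j\<in>UNIV. a i j * partial j (partial i u) p)
        \<le> - \<epsilon> * (W2 / R\<^sup>2 * (\<Sum>i\<in>UNIV. \<Sum>j\<in>UNIV. a i j * (p - x0) $ i * (p - x0) $ j)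
               - W' (\<sigma> x0 p) / R * (\<Sum>i\<in>UNIV. a i i))"
    unfolding Hsum q_def w1_def by simp
qed

text \<open>
  The Hopf estimate. At a negative minimum \<open>p\<close> of \<open>v - \<epsilon> W(\<sigma>)\<close>, where \<open>v = M - u\<close>, in the annulus
  \<open>R/2 < |x - x0| < R\<close>, the second-, first- and
  zeroth-order parts of \<open>L[u]\<close> are bounded above, with \<open>\<Lambda>\<close> and \<open>W'\<close> taken at \<open>\<sigma>(p)\<close> and
  \<open>n\<close> the dimension, by \<open>- \<epsilon> \<Lambda> W' (K / 4 - n / R)\<close>, \<open>\<epsilon> n \<Lambda> W'\<close> and \<open>\<epsilon> \<Lambda> W'\<close>. The factor \<open>1/4\<close> comes
  from \<open>|p - x0| \<ge> R/2\<close>, which is why the comparison stays away from the centre. The sum is negative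
  by the choice of \<open>K\<close>.
\<close>
lemma barrier_lower_bound:
  fixes u c :: "real^'n \<Rightarrow> real" and a :: "'n \<Rightarrow> 'n \<Rightarrow> real^'n \<Rightarrow> real"
    and b :: "'n \<Rightarrow> real^'n \<Rightarrow> real" and \<Lambda> :: "real \<Rightarrow> real" and M R :: real
  assumes "open \<Omega>" and C2: "C2_on u \<Omega>" and R: "R > 0" and sub: "cball x0 R \<subseteq> \<Omega>"
    and less: "\<And>x. x \<in> ball x0 R \<Longrightarrow> u x < M" and le: "\<And>x. x \<in> cball x0 R \<Longrightarrow> u x \<le> M"
    and \<Lambda>: "continuous_on {0<..R/2} \<Lambda>" "antimono_on {0<..R/2} \<Lambda>" "\<And>t. t \<in> {0<..R/2} \<Longrightarrow> \<Lambda> t > 0"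
      "set_integrable lborel {0<..R/2} \<Lambda>"
    and lower: "\<And>x y. x \<in> ball x0 R \<Longrightarrow> R - dist x0 x \<le> R/2 \<Longrightarrow> (norm y)\<^sup>2 \<le> quad_form a x y"
    and upper: "\<And>x y. x \<in> ball x0 R \<Longrightarrow> R - dist x0 x \<le> R/2 \<Longrightarrow>
        quad_form a x y \<le> \<Lambda> (R - dist x0 x) * (norm y)\<^sup>2"
    and b: "\<And>x i. x \<in> ball x0 R \<Longrightarrow> R - dist x0 x \<le> R/2 \<Longrightarrow> \<bar>b i x\<bar> \<le> \<Lambda> (R - dist x0 x)"
    and c: "\<And>x. x \<in> ball x0 R \<Longrightarrow> R - dist x0 x \<le> R/2 \<Longrightarrow> c x \<ge> - \<Lambda> (R - dist x0 x) / (R - dist x0 x)"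
    and cM: "\<And>x. x \<in> ball x0 R \<Longrightarrow> c x * M \<le> 0"
    and L: "\<And>x. x \<in> ball x0 R \<Longrightarrow> linop a b c u x \<ge> 0"
  obtains \<epsilon> where "\<epsilon> > 0"
    "\<And>x. x \<in> cball x0 R - ball x0 (R/2) \<Longrightarrow> u x \<le> M - \<epsilon> * ((R\<^sup>2 - (norm (x - x0))\<^sup>2) / (2 * R))"
proof -
  let ?N = "real CARD('n)"
  \<comment> \<open>The summand 2, where 1 would balance the zeroth-order term, makes the final inequality strict.\<close>
  define K where "K = 4 * (?N / R + ?N + 2)"
  have K: "K \<ge> 0" using R by (simp add: K_def)
  define \<sigma> where "\<sigma> x = (R\<^sup>2 - (norm (x - x0))\<^sup>2) / (2 * R)" for x :: "real^'n"
  obtain W W' :: "real \<Rightarrow> real" where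
    Wc: "continuous_on {0..R/2} W" and
    W: "\<And>s. s \<in> {0<..<R/2} \<Longrightarrow> (W has_real_derivative W' s) (at s)" and
    W': "\<And>s. s \<in> {0<..<R/2} \<Longrightarrow> (W' has_real_derivative K * \<Lambda> s * W' s) (at s)" and
    sW: "\<And>s. s \<in> {0..R/2} \<Longrightarrow> s \<le> W s" and Ws: "\<And>s. s \<in> {0..R/2} \<Longrightarrow> W s \<le> s * W' s" and
    W0: "W 0 = 0" and W'1: "\<And>s. s \<in> {0..R/2} \<Longrightarrow> W' s \<ge> 1"
    using barrier_exists[OF \<Lambda>(1) less_imp_le[OF \<Lambda>(3)] \<Lambda>(4) K] by blast
  define A where "A = cball x0 R - ball x0 (R/2)"
  have \<sigma>_dist: "\<sigma> x = (R - dist x0 x) * (R + dist x0 x) / (2 * R)" for x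
    by (simp add: \<sigma>_def dist_norm norm_minus_commute power2_eq_square algebra_simps)
  have \<sigma>_A: "\<sigma> x \<in> {0..3 * R / 8}" if x: "x \<in> A" for x
  proof -
    have r: "R / 2 \<le> dist x0 x" "dist x0 x \<le> R" using x by (auto simp: A_def)
    have "(R / 2)\<^sup>2 \<le> (dist x0 x)\<^sup>2" "(dist x0 x)\<^sup>2 \<le> R\<^sup>2"
      using r R by (auto intro!: power_mono)
    then show ?thesis
      using R by (simp add: \<sigma>_def dist_norm norm_minus_commute power2_eq_square field_simps)
  qed
  have \<sigma>_A': "\<sigma> x \<in> {0..R/2}" if x: "x \<in> A" for x
    using \<sigma>_A[OF x] R by auto
  have \<sigma>_le: "\<sigma> x \<le> R - dist x0 x" and \<sigma>_pos: "0 < \<sigma> x" if x: "x \<in> ball x0 R" for x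
  proof -
    have r: "dist x0 x < R" using x by simp
    then have "(R - dist x0 x) * (R + dist x0 x) \<le> (R - dist x0 x) * (2 * R)"
      by (intro mult_left_mono) auto
    then show "\<sigma> x \<le> R - dist x0 x" using R by (simp add: \<sigma>_dist divide_le_eq)
    have "0 < (R - dist x0 x) * (R + dist x0 x)"
      using r R by (intro mult_pos_pos) (auto simp: add_pos_nonneg)
    then show "0 < \<sigma> x" using R by (simp add: \<sigma>_dist)
  qed
  have \<sigma>_cont: "continuous_on X \<sigma>" for X
    unfolding \<sigma>_def[abs_def] by (intro continuous_intros) (use R in auto)
  have cu: "continuous_on \<Omega> u"
    using C2 by (auto simp: C2_on_def differentiable_imp_continuous_on)
  have A_compact: "compact A"
    unfolding A_def by (intro compact_diff) auto
  have A_sub: "A \<subseteq> \<Omega>" using sub by (auto simp: A_def)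

  have "compact (sphere x0 (R/2))" "continuous_on (sphere x0 (R/2)) u"
    using continuous_on_subset[OF cu] sub R by (auto simp: subset_iff)
  moreover have "sphere x0 (R/2) \<noteq> {}" using R by simp
  ultimately obtain x1 where x1: "x1 \<in> sphere x0 (R/2)" "\<And>x. x \<in> sphere x0 (R/2) \<Longrightarrow> u x \<le> u x1"
    using continuous_attains_sup[of "sphere x0 (R/2)" u] by blast
  \<comment> \<open>The value of \<open>\<sigma>\<close> on the inner sphere; \<open>\<epsilon>\<close> is then the largest factor for which
    \<open>\<epsilon> W(\<sigma>) \<le> M - u\<close> is sure to hold there.\<close>
  define \<sigma>1 where "\<sigma>1 = 3 * R / 8"
  have \<sigma>1: "\<sigma>1 \<in> {0..R/2}" "\<sigma>1 > 0" using R by (auto simp: \<sigma>1_def)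
  have \<sigma>_sphere: "\<sigma> x = \<sigma>1" if "x \<in> sphere x0 (R/2)" for x
  proof -
    have r: "dist x0 x = R/2" using that by simp
    show ?thesis unfolding \<sigma>_dist \<sigma>1_def r using R by (simp add: field_simps)
  qed
  have W1: "W \<sigma>1 > 0" using sW[OF \<sigma>1(1)] \<sigma>1(2) by simp
  define \<epsilon> where "\<epsilon> = (M - u x1) / W \<sigma>1"
  have "u x1 < M" using x1(1) R by (intro less) auto
  then have \<epsilon>: "\<epsilon> > 0" using W1 by (simp add: \<epsilon>_def)
  define \<phi> where "\<phi> x = M - u x - \<epsilon> * W (\<sigma> x)" for x
  have \<phi>_cont: "continuous_on A \<phi>"
    unfolding \<phi>_def[abs_def]
    by (intro continuous_intros continuous_on_subset[OF cu A_sub]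
        continuous_on_compose2[OF Wc \<sigma>_cont]) (use \<sigma>_A' in auto)
  have "x1 \<in> A" using x1 R by (auto simp: A_def)
  then obtain p where p: "p \<in> A" "\<And>x. x \<in> A \<Longrightarrow> \<phi> p \<le> \<phi> x"
    using continuous_attains_inf[OF A_compact _ \<phi>_cont] by blast
  have "\<phi> p \<ge> 0"
  proof (rule ccontr)
    assume "\<not> \<phi> p \<ge> 0"
    then have neg: "\<phi> p < 0" by simp
    have "dist x0 p \<noteq> R"
    proof
      assume *: "dist x0 p = R"
      then have "\<sigma> p = 0" by (simp add: \<sigma>_dist)
      then show False using neg le[of p] * by (simp add: \<phi>_def W0)
    qed
    moreover have "dist x0 p \<noteq> R/2"
    proof
      assume *: "dist x0 p = R/2"
      then have "\<phi> p \<ge> M - u x1 - \<epsilon> * W \<sigma>1"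
        using x1(2)[of p] \<sigma>_sphere[of p] by (simp add: \<phi>_def)
      also have "M - u x1 - \<epsilon> * W \<sigma>1 = 0" using W1 by (simp add: \<epsilon>_def)
      finally show False using neg by simp
    qed
    ultimately have pb: "p \<in> ball x0 R" "R/2 < dist x0 p" using p(1) by (auto simp: A_def)
    define U where "U = ball x0 R - cball x0 (R/2)"
    have UA: "U \<subseteq> A" by (auto simp: U_def A_def)
    define s where "s = \<sigma> p"
    define d where "d = R - dist x0 p"
    define q where "q = p - x0"
    have s: "s \<in> {0<..<R/2}"
      using \<sigma>_pos[OF pb(1)] \<sigma>_A[OF p(1)] R by (auto simp: s_def)
    have s': "s \<in> {0..R/2}" and s'': "s \<in> {0<..R/2}" using s by auto
    have d: "0 < d" "d \<le> R/2" "s \<le> d" using pb \<sigma>_le[OF pb(1)] by (auto simp: d_def s_def)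
    have U: "open U" "p \<in> U" "U \<subseteq> \<Omega>"
      using pb UA A_sub by (auto simp: U_def)
    have U\<sigma>: "\<sigma> x \<in> {0<..<R/2}" if "x \<in> U" for x
      using that UA \<sigma>_pos[of x] \<sigma>_A[of x] R by (force simp: U_def)
    have min: "M - u p - \<epsilon> * W (\<sigma> p) \<le> M - u x - \<epsilon> * W (\<sigma> x)" if "x \<in> U" for x
      using p(2)[of x] UA that by (auto simp: \<phi>_def)
    define w where "w = W' s"
    have w: "w \<ge> 1" using W'1[OF s'] by (simp add: w_def)
    define l where "l = \<Lambda> s"
    have l: "l > 0" using \<Lambda>(3)[OF s''] by (simp add: l_def)
    have ld: "\<Lambda> d \<le> l"
      using \<Lambda>(2) s'' d unfolding l_def monotone_on_def by auto
    have \<Lambda>d: "\<Lambda> d > 0" using \<Lambda>(3) d by auto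
    note pd = pb(1) d(2)[unfolded d_def]
    have psd: "(\<Sum>i\<in>UNIV. \<Sum>j\<in>UNIV. a i j p * y i * y j) \<ge> 0" for y
      using order_trans[OF zero_le_power2 lower[OF pd, of "\<chi> i. y i"]] by (simp add: quad_form_def)
    note at_min = barrier_contact_conditions[OF assms(1) C2 R U, of x0 "R/2" W W' "K * \<Lambda> (\<sigma> p) * W' (\<sigma> p)" M \<epsilon>,
        folded \<sigma>_def, OF U\<sigma> W W'[OF s, unfolded s_def] min]
    have grad: "partial k u p = \<epsilon> * w * q $ k / R" for k
      using at_min(1)[of k] by (simp add: w_def s_def q_def)
    have hess: "(\<Sum>i\<in>UNIV. \<Sum>j\<in>UNIV. a i j p * partial j (partial i u) p)
        \<le> - \<epsilon> * (K * l * w / R\<^sup>2 * quad_form a p q - w / R * (\<Sum>i\<in>UNIV. a i i p))"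
      using at_min(2)[of "\<lambda>i j. a i j p", OF _ _ _ psd] by (simp add: w_def s_def q_def l_def quad_form_def)
    have trace: "(\<Sum>i\<in>UNIV. a i i p) \<le> ?N * l"
    proof -
      have "a i i p \<le> l" for i
      proof -
        have "quad_form a p (axis i 1) = a i i p"
          by (simp add: quad_form_def axis_def mult_delta_right mult_delta_left)
        then show ?thesis using upper[OF pd, of "axis i 1"] ld by (simp add: d_def)
      qed
      then show ?thesis using sum_bounded_above[of UNIV "\<lambda>i. a i i p" l] by simp
    qed
    have nq: "norm q = dist x0 p" by (simp add: q_def dist_norm norm_minus_commute)
    have quad: "quad_form a p q \<ge> R\<^sup>2 / 4"
    proof -
      have "(R/2)\<^sup>2 \<le> (norm q)\<^sup>2" using pb(2) R nq by (intro power_mono) auto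
      also have "\<dots> \<le> quad_form a p q" by (rule lower[OF pd])
      finally show ?thesis by (simp add: power_divide)
    qed
    have second: "(\<Sum>i\<in>UNIV. \<Sum>j\<in>UNIV. a i j p * partial j (partial i u) p)
        \<le> - \<epsilon> * (K * l * w / 4 - w * ?N * l / R)"
    proof -
      have "K * l * w / R\<^sup>2 * (R\<^sup>2 / 4) \<le> K * l * w / R\<^sup>2 * quad_form a p q"
        using quad K l w by (intro mult_left_mono) auto
      then have "K * l * w / 4 \<le> K * l * w / R\<^sup>2 * quad_form a p q" using R by simp
      moreover have "w / R * (\<Sum>i\<in>UNIV. a i i p) \<le> w / R * (?N * l)"
        using trace w R by (intro mult_left_mono) auto
      then have "w / R * (\<Sum>i\<in>UNIV. a i i p) \<le> w * ?N * l / R" by (simp add: mult_ac)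
      ultimately have "K * l * w / 4 - w * ?N * l / R
          \<le> K * l * w / R\<^sup>2 * quad_form a p q - w / R * (\<Sum>i\<in>UNIV. a i i p)" by linarith
      then have "\<epsilon> * (K * l * w / 4 - w * ?N * l / R)
          \<le> \<epsilon> * (K * l * w / R\<^sup>2 * quad_form a p q - w / R * (\<Sum>i\<in>UNIV. a i i p))"
        using \<epsilon> by (intro mult_left_mono) auto
      then show ?thesis using hess by linarith
    qed
    have first: "(\<Sum>i\<in>UNIV. b i p * partial i u p) \<le> \<epsilon> * (w * ?N * l)"
    proof -
      have "b i p * partial i u p \<le> \<epsilon> * w * l" for i
      proof -
        have "\<bar>q $ i\<bar> \<le> R" using component_le_norm_cart[of q i] nq pb(1) by simp
        then have "\<bar>partial i u p\<bar> \<le> \<epsilon> * w"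
          using \<epsilon> w R unfolding grad by (simp add: abs_mult divide_le_eq mult_left_mono)
        moreover have "\<bar>b i p\<bar> \<le> l" using b[OF pd, of i] ld by (simp add: d_def)
        ultimately have "\<bar>b i p\<bar> * \<bar>partial i u p\<bar> \<le> l * (\<epsilon> * w)"
          using l by (intro mult_mono) auto
        then show ?thesis by (simp add: abs_mult[symmetric] mult_ac)
      qed
      then show ?thesis using sum_bounded_above[of UNIV "\<lambda>i. b i p * partial i u p" "\<epsilon> * w * l"]
        by (simp add: mult_ac)
    qed
    have zeroth: "c p * u p \<le> \<epsilon> * (l * w)"
    proof -
      have v: "0 < M - u p" "M - u p < \<epsilon> * W s" using less[OF pb(1)] neg by (auto simp: \<phi>_def s_def)
      have "c p * u p = c p * M - c p * (M - u p)" by (simp add: algebra_simps)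
      also have "\<dots> \<le> \<Lambda> d / d * (M - u p)"
      proof -
        have "- c p * (M - u p) \<le> \<Lambda> d / d * (M - u p)"
          using c[OF pd] v by (intro mult_right_mono) (auto simp: d_def)
        then show ?thesis using cM[OF pb(1)] by simp
      qed
      also have "\<dots> \<le> l / s * (\<epsilon> * (s * w))"
      proof (rule mult_mono)
        show "\<Lambda> d / d \<le> l / s" using ld \<Lambda>d d s by (intro frac_le) auto
        have "\<epsilon> * W s \<le> \<epsilon> * (s * w)" using Ws[OF s'] \<epsilon> by (simp add: w_def)
        then show "M - u p \<le> \<epsilon> * (s * w)" using v by simp
      qed (use v l s in auto)
      also have "\<dots> = \<epsilon> * (l * w)" using s by simp
      finally show ?thesis .
    qed
    have "linop a b c u p \<le> - \<epsilon> * (K * l * w / 4 - w * ?N * l / R) + \<epsilon> * (w * ?N * l) + \<epsilon> * (l * w)"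
      unfolding linop_def using first second zeroth by linarith
    also have "\<dots> = - (\<epsilon> * l * w)"
      unfolding K_def using R by (simp add: field_simps)
    also have "\<dots> < 0" using \<epsilon> l w by simp
    finally show False using L[OF pb(1)] by simp
  qed
  show thesis
  proof (rule that[OF \<epsilon>])
    fix x assume "x \<in> cball x0 R - ball x0 (R/2)"
    then have x: "x \<in> A" by (simp add: A_def)
    have "\<epsilon> * \<sigma> x \<le> \<epsilon> * W (\<sigma> x)" using sW[OF \<sigma>_A'[OF x]] \<epsilon> by simp
    then show "u x \<le> M - \<epsilon> * ((R\<^sup>2 - (norm (x - x0))\<^sup>2) / (2 * R))"
      using p(2)[OF x] \<open>\<phi> p \<ge> 0\<close> by (simp add: \<phi>_def \<sigma>_def)
  qed
qed

text \<open>
  On the segment from \<open>z\<close> to the centre, \<open>(R^2 - |x - x0|^2) / (2 R)\<close> grows with positive slope at \<open>z\<close>,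
  so the bound forces \<open>u\<close> to decrease with nonzero slope, whereas its gradient vanishes at \<open>z\<close>.
\<close>
lemma barrier_bound_contradicts_interior_max:
  fixes u :: "real^'n \<Rightarrow> real" and M R \<epsilon> :: real
  assumes "open \<Omega>" "u differentiable_on \<Omega>" "z \<in> \<Omega>" "\<And>x. x \<in> \<Omega> \<Longrightarrow> u x \<le> u z"
    and z: "z \<in> sphere x0 R" and R: "R > 0" and \<epsilon>: "\<epsilon> > 0"
    and bound: "\<And>x. x \<in> cball x0 R - ball x0 (R/2) \<Longrightarrow> u x \<le> u z - \<epsilon> * ((R\<^sup>2 - (norm (x - x0))\<^sup>2) / (2 * R))"
  shows False
proof -
  define y where "y = x0 - z"
  have ny: "norm y = R" using z by (simp add: y_def dist_norm)
  define D where "D = (\<Sum>i\<in>UNIV. partial i u (z + 0 *\<^sub>R y) * y $ i)"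
  have D: "((\<lambda>t. u (z + t *\<^sub>R y)) has_real_derivative D) (at 0)"
    unfolding D_def using assms by (intro DERIV_along_line[of u \<Omega>]) auto
  obtain e where e: "e > 0" "ball z e \<subseteq> \<Omega>" using assms(1,3) open_contains_ball by blast
  have "D = 0"
  proof (rule DERIV_local_max[OF D])
    show "e / R > 0" using e R by simp
    show "\<forall>t. \<bar>0 - t\<bar> < e / R \<longrightarrow> u (z + t *\<^sub>R y) \<le> u (z + 0 *\<^sub>R y)"
    proof (intro allI impI)
      fix t assume "\<bar>0 - t\<bar> < e / R"
      then have "z + t *\<^sub>R y \<in> ball z e" using R ny by (simp add: dist_norm field_simps)
      then show "u (z + t *\<^sub>R y) \<le> u (z + 0 *\<^sub>R y)" using e assms(4) by auto
    qed
  qed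
  then have "((\<lambda>t. u (z + t *\<^sub>R y) + \<epsilon> * (R * t / 2)) has_real_derivative \<epsilon> * R / 2) (at 0)"
    using D by (auto intro!: derivative_eq_intros)
  moreover have "\<epsilon> * R / 2 > 0" using \<epsilon> R by simp
  ultimately obtain f where f: "f > 0" "\<And>h. 0 < h \<Longrightarrow> h < f \<Longrightarrow> u z < u (z + h *\<^sub>R y) + \<epsilon> * (R * h / 2)"
    by (force dest: DERIV_pos_inc_right)
  define t where "t = min f (1/2) / 2"
  have t: "0 < t" "t < f" "t \<le> 1/2" using f by (auto simp: t_def)
  have n: "norm (z + t *\<^sub>R y - x0) = (1 - t) * R"
  proof -
    have "z + t *\<^sub>R y - x0 = (t - 1) *\<^sub>R y" by (simp add: y_def algebra_simps)
    then show ?thesis using t ny by simp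
  qed
  have "R/2 \<le> (1 - t) * R" "(1 - t) * R \<le> R" using t R by (simp_all add: field_simps)
  then have "u (z + t *\<^sub>R y) \<le> u z - \<epsilon> * ((R\<^sup>2 - (norm (z + t *\<^sub>R y - x0))\<^sup>2) / (2 * R))"
    using n by (intro bound) (simp add: dist_norm norm_minus_commute)
  also have "(R\<^sup>2 - (norm (z + t *\<^sub>R y - x0))\<^sup>2) / (2 * R) = R * (2 * t - t * t) / 2"
    unfolding n using R by (simp add: power2_eq_square field_simps)
  finally have 1: "u (z + t *\<^sub>R y) \<le> u z - \<epsilon> * (R * (2 * t - t * t) / 2)" .
  have "t * t \<le> 1 * t" using t by (intro mult_right_mono) auto
  then have "R * t \<le> R * (2 * t - t * t)" using R by (intro mult_left_mono) auto
  then have "\<epsilon> * (R * t / 2) \<le> \<epsilon> * (R * (2 * t - t * t) / 2)"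
    using \<epsilon> by (intro mult_left_mono) auto
  with 1 f(2)[OF t(1,2)] show False by simp
qed

section \<open>The strong maximum principle\<close>

text \<open>
  A point of the smaller closed ball at distance \<open>dist x z\<close> from \<open>x\<close> gives equality in the triangle
  inequality, so strict convexity of the norm makes it lie diametrically opposite to \<open>x\<close>.
  This replaces a ball that may touch the boundary of the domain by one that does not, keeping
  the contact point \<open>z\<close>.
\<close>
lemma cball_midpoint_subset_insert_ball:
  fixes x z :: "'a::real_inner"
  assumes "x \<noteq> z"
  shows "cball (midpoint x z) (dist x z / 2) \<subseteq> insert z (ball x (dist x z))"
proof
  define m R where "m = midpoint x z" and "R = dist x z / 2"
  have R: "R > 0" "dist x m = R" using assms by (simp_all add: R_def m_def dist_midpoint)
  fix y assume "y \<in> cball (midpoint x z) (dist x z / 2)"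
  then have y: "dist m y \<le> R" by (simp add: m_def R_def)
  show "y \<in> insert z (ball x (dist x z))"
  proof (rule ccontr)
    assume "y \<notin> insert z (ball x (dist x z))"
    then have ny: "y \<noteq> z" "2 * R \<le> dist x y" by (auto simp: R_def)
    moreover have "dist x y \<le> dist x m + dist m y" by (rule dist_triangle)
    ultimately have eq: "dist x y = dist x m + dist m y" "dist m y = R"
      using y R by simp_all
    have "norm (m - x) = R" "norm (y - m) = R"
      using R eq(2) by (simp_all add: dist_norm norm_minus_commute)
    moreover have "norm ((m - x) + (y - m)) = norm (m - x) + norm (y - m)"
      using eq(1) by (simp add: dist_norm norm_minus_commute)
    ultimately have "R *\<^sub>R (y - m) = R *\<^sub>R (m - x)"
      unfolding norm_triangle_eq by metis
    then have "y - m = m - x" using R by simp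
    then have "y = m + m - x" by (simp add: algebra_simps)
    also have "\<dots> = z" by (simp add: m_def midpoint_def scaleR_2[symmetric] algebra_simps)
    finally show False using ny(1) by simp
  qed
qed

theorem theorem2p3:
  fixes \<Omega> S :: "(real^'n) set"
    and a :: "'n \<Rightarrow> 'n \<Rightarrow> real^'n \<Rightarrow> real"
    and b :: "'n \<Rightarrow> real^'n \<Rightarrow> real"
    and c u :: "real^'n \<Rightarrow> real"
    and M :: ereal
  assumes "bounded_domain \<Omega>"
    and "outward_ball_property \<Omega> S"
    and "elliptic_on (\<Omega> - S) a"
    and "C2_on u \<Omega>"
    and "\<forall>x \<in> \<Omega> - S. linop a b c u x \<ge> 0"
    and "\<And>x0 R. R > 0 \<Longrightarrow> ball x0 R \<subseteq> \<Omega> - S \<Longrightarrow> sphere x0 R \<inter> frontier \<Omega> = {} \<Longrightarrow>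
           \<exists>\<Lambda> :: real \<Rightarrow> real.
             continuous_on {0<..R/2} \<Lambda> \<and> antimono_on {0<..R/2} \<Lambda> \<and>
             (\<forall>t \<in> {0<..R/2}. \<Lambda> t > 0) \<and> set_integrable lborel {0<..R/2} \<Lambda> \<and>
             (\<forall>x \<in> ball x0 R. let d = infdist x (sphere x0 R) in d \<le> R/2 \<longrightarrow>
                (\<forall>y. (norm y)\<^sup>2 \<le> quad_form a x y \<and> quad_form a x y \<le> \<Lambda> d * (norm y)\<^sup>2) \<and>
                (\<forall>i. \<bar>b i x\<bar> \<le> \<Lambda> d) \<and>
                c x \<ge> - \<Lambda> d / d)"
    and "M = (SUP x\<in>\<Omega>. ereal (u x))"
    and "M = 0 \<or> (M > 0 \<and> (\<forall>x \<in> \<Omega> - S. c x \<le> 0))"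
  shows "(\<forall>x\<in>\<Omega>. M > ereal (u x)) \<or> u constant_on \<Omega>"
proof (rule disjCI)
  assume "\<not> u constant_on \<Omega>"
  show "\<forall>x\<in>\<Omega>. M > ereal (u x)"
  proof (rule ccontr)
    assume "\<not> (\<forall>x\<in>\<Omega>. M > ereal (u x))"
    then obtain x1 where x1: "x1 \<in> \<Omega>" "M \<le> ereal (u x1)" by (auto simp: not_less)
    define m where "m = u x1"
    have "ereal (u x1) \<le> M" unfolding assms(7) using x1(1) by (rule SUP_upper)
    then have Mm: "M = ereal m" using x1(2) by (simp add: m_def)
    have le: "u x \<le> m" if "x \<in> \<Omega>" for x
    proof -
      have "ereal (u x) \<le> M" unfolding assms(7) using that by (rule SUP_upper)
      then show ?thesis by (simp add: Mm)
    qed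
    have op: "open \<Omega>" using assms(1) by (simp add: bounded_domain_def)
    have du: "u differentiable_on \<Omega>" using assms(4) by (simp add: C2_on_def)
    define T where "T = {x \<in> \<Omega>. u x = m}"
    have "closedin (top_of_set \<Omega>) T"
      unfolding T_def
      using continuous_closedin_preimage_constant[OF differentiable_imp_continuous_on[OF du]] .
    moreover have "T \<noteq> {}" using x1 by (auto simp: T_def m_def)
    moreover have "T \<subset> \<Omega>"
      using \<open>\<not> u constant_on \<Omega>\<close> by (auto simp: T_def constant_on_def)
    ultimately have T: "T \<noteq> {} \<and> closedin (top_of_set \<Omega>) T \<and> T \<subset> \<Omega>" by simp
    obtain R' x' where ball': "R' > 0" "ball x' R' \<subseteq> \<Omega> - (T \<union> S)" "sphere x' R' \<inter> T \<noteq> {}"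
      using mp[OF spec[OF conjunct2[OF assms(2)[unfolded outward_ball_property_def]]] T] by meson
    obtain z where "z \<in> sphere x' R'" "z \<in> T" using ball'(3) by blast
    then have z: "dist x' z = R'" "z \<in> T" by simp_all
    define R where "R = R' / 2"
    define x0 where "x0 = midpoint x' z"
    have R: "R > 0" using ball' by (simp add: R_def)
    have dz: "dist x0 z = R"
      using z by (simp add: x0_def R_def dist_midpoint)
    have "x' \<noteq> z" using z ball'(1) by auto
    have inner: "cball x0 R \<subseteq> insert z (ball x' R')"
      using cball_midpoint_subset_insert_ball[OF \<open>x' \<noteq> z\<close>] unfolding x0_def R_def z(1) .
    have sub: "cball x0 R \<subseteq> \<Omega>" using inner ball' z by (auto simp: T_def)
    have "z \<notin> ball x0 R" using dz by simp
    have bsub: "ball x0 R \<subseteq> \<Omega> - (T \<union> S)" using inner ball'(2) ball_subset_cball[of x0 R] \<open>z \<notin> ball x0 R\<close> by blast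
    have frontier: "sphere x0 R \<inter> frontier \<Omega> = {}"
      using sub op sphere_cball[of x0 R] by (auto simp: frontier_def interior_open)
    have ball_S: "ball x0 R \<subseteq> \<Omega> - S" using bsub by auto
    obtain \<Lambda> :: "real \<Rightarrow> real" where \<Lambda>:
      "continuous_on {0<..R/2} \<Lambda>" "antimono_on {0<..R/2} \<Lambda>" "\<forall>t \<in> {0<..R/2}. \<Lambda> t > 0"
      "set_integrable lborel {0<..R/2} \<Lambda>" and
      bounds: "\<forall>x \<in> ball x0 R. let d = infdist x (sphere x0 R) in d \<le> R/2 \<longrightarrow>
                (\<forall>y. (norm y)\<^sup>2 \<le> quad_form a x y \<and> quad_form a x y \<le> \<Lambda> d * (norm y)\<^sup>2) \<and>
                (\<forall>i. \<bar>b i x\<bar> \<le> \<Lambda> d) \<and>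
                c x \<ge> - \<Lambda> d / d"
      using assms(6)[OF R ball_S frontier] by (elim exE conjE) (rule that)
    have coeff: "(\<forall>y. (norm y)\<^sup>2 \<le> quad_form a x y \<and> quad_form a x y \<le> \<Lambda> (R - dist x0 x) * (norm y)\<^sup>2) \<and>
                (\<forall>i. \<bar>b i x\<bar> \<le> \<Lambda> (R - dist x0 x)) \<and>
                c x \<ge> - \<Lambda> (R - dist x0 x) / (R - dist x0 x)"
      if "x \<in> ball x0 R" "R - dist x0 x \<le> R/2" for x
      using bspec[OF bounds that(1)] that(2) unfolding infdist_sphere[OF that(1)] Let_def by blast
    have cm: "c x * m \<le> 0" if "x \<in> ball x0 R" for x
    proof -
      have "x \<in> \<Omega> - S" using ball_S that by blast
      then show ?thesis using assms(8) unfolding Mm by (auto intro: mult_nonpos_nonneg)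
    qed
    have less: "u x < m" if "x \<in> ball x0 R" for x
      using bsub that le[of x] by (fastforce simp: T_def)
    obtain \<epsilon> where \<epsilon>: "\<epsilon> > 0" and
      bound: "\<And>x. x \<in> cball x0 R - ball x0 (R/2) \<Longrightarrow> u x \<le> m - \<epsilon> * ((R\<^sup>2 - (norm (x - x0))\<^sup>2) / (2 * R))"
    proof (rule barrier_lower_bound[OF op assms(4) R sub less _ \<Lambda>(1,2) bspec[OF \<Lambda>(3)] \<Lambda>(4), of a b c])
      show "u x \<le> m" if "x \<in> cball x0 R" for x using le sub that by auto
      show "linop a b c u x \<ge> 0" if "x \<in> ball x0 R" for x using assms(5) bsub that by auto
    qed (use coeff cm in blast)+
    have uz: "u z = m" "z \<in> \<Omega>" using z by (auto simp: T_def)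
    show False
      using barrier_bound_contradicts_interior_max[OF op du uz(2), of x0 R \<epsilon>] le bound R \<epsilon> dz
      by (simp add: uz)
  qed
qed

end
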